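(* $\gamma_b=\dfrac23$, where $$\gamma_{b,T}=\limsup_{n\to\infty}\frac{\mathrm{ex}_b(n,T)}{(|T|-2)\,n}\quad\text{for a tree }T,\qquad \gamma_b=\lim_{k\to\infty}\inf\{\gamma_{b,T}:T\in\mathcal T_k\},$$ and $\mathcal T_k$ is the set of all trees on at least $k$ vertices.
   Context: All graphs are finite and simple. $|T|$ is the number of vertices of $T$. $\mathrm{ex}_b(n,T)$ is the largest number of edges of a bipartite graph with both parts of size $n$ that contains no (not necessarily induced) subgraph isomorphic to $T$. In the definition of $\gamma_b$, $k\ge 3$ so that $|T|-2>0$. *)

theory Defs
  imports "HOL-Library.Extended_Real"
begin

type_synonym 'a ugraph = "'a set \<times> 'a set set"

abbreviation verts :: "'a ugraph \<Rightarrow> 'a set" where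
  "verts G \<equiv> fst G"

abbreviation edges :: "'a ugraph \<Rightarrow> 'a set set" where
  "edges G \<equiv> snd G"

definition simple_graph :: "'a ugraph \<Rightarrow> bool" where
  "simple_graph G \<longleftrightarrow> finite (verts G) \<and> (\<forall>e\<in>edges G. e \<subseteq> verts G \<and> card e = 2)"

definition is_walk :: "'a ugraph \<Rightarrow> 'a list \<Rightarrow> bool" where
  "is_walk G p \<longleftrightarrow> p \<noteq> [] \<and> set p \<subseteq> verts G \<and> successively (\<lambda>u v. {u, v} \<in> edges G) p"

definition is_cycle :: "'a ugraph \<Rightarrow> 'a list \<Rightarrow> bool" where
  "is_cycle G c \<longleftrightarrow> is_walk G c \<and> distinct c \<and> length c \<ge> 3 \<and> {last c, hd c} \<in> edges G"

definition connected_graph :: "'a ugraph \<Rightarrow> bool" where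
  "connected_graph G \<longleftrightarrow> verts G \<noteq> {} \<and>
     (\<forall>u\<in>verts G. \<forall>v\<in>verts G. \<exists>p. is_walk G p \<and> hd p = u \<and> last p = v)"

definition is_tree :: "'a ugraph \<Rightarrow> bool" where
  "is_tree G \<longleftrightarrow> simple_graph G \<and> connected_graph G \<and> (\<nexists>c. is_cycle G c)"

definition is_subgraph :: "'a ugraph \<Rightarrow> 'a ugraph \<Rightarrow> bool" where
  "is_subgraph H G \<longleftrightarrow> verts H \<subseteq> verts G \<and> edges H \<subseteq> edges G"

definition isomorphic_graphs :: "'a ugraph \<Rightarrow> 'b ugraph \<Rightarrow> bool" where
  "isomorphic_graphs G H \<longleftrightarrow>
     (\<exists>f. bij_betw f (verts G) (verts H) \<and> edges H = (\<lambda>e. f ` e) ` edges G)"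

definition contains_copy :: "'a ugraph \<Rightarrow> 'b ugraph \<Rightarrow> bool" where
  "contains_copy G T \<longleftrightarrow> (\<exists>S. simple_graph S \<and> is_subgraph S G \<and> isomorphic_graphs T S)"

definition balanced_bipartite :: "nat \<Rightarrow> 'a ugraph \<Rightarrow> bool" where
  "balanced_bipartite n G \<longleftrightarrow> simple_graph G \<and>
     (\<exists>A B. verts G = A \<union> B \<and> A \<inter> B = {} \<and> card A = n \<and> card B = n \<and>
        (\<forall>e\<in>edges G. \<exists>a\<in>A. \<exists>b\<in>B. e = {a, b}))"

(* Every finite graph is isomorphic to one with natural numbers as vertices, so nothing is lost
   by letting the host graphs (here) and the trees (below) have vertices in nat. The set is
   finite, and it is nonempty as soon as T has an edge, since the edgeless graph qualifies. *)
definition ex_b :: "nat \<Rightarrow> 'a ugraph \<Rightarrow> nat" where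
  "ex_b n T = Max {card (edges G) | G :: nat ugraph. balanced_bipartite n G \<and> \<not> contains_copy G T}"

(* Limsup, infimum and limit are taken in the extended reals, so that they exist without
   boundedness side conditions. The value is meaningful for trees on at least 3 vertices. *)
definition gamma_b_tree :: "'a ugraph \<Rightarrow> ereal" where
  "gamma_b_tree T =
     limsup (\<lambda>n. ereal (real (ex_b n T) / ((real (card (verts T)) - 2) * real n)))"

definition trees_at_least :: "nat \<Rightarrow> nat ugraph set" where
  "trees_at_least k = {T. is_tree T \<and> k \<le> card (verts T)}"

definition gamma_b :: ereal where
  "gamma_b = lim (\<lambda>k. INF T\<in>trees_at_least k. gamma_b_tree T)"

end

theory Submission
  imports Defs
begin

text \<open>
  Lower bound: let a connected graph on \<open>t\<close> vertices have colour classes of sizes \<open>a \<le> b\<close>.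
  It embeds neither into disjoint copies of \<open>K\<^bsub>b-1,b-1\<^esub>\<close> nor into two disjoint copies of
  \<open>K\<^bsub>a-1,n-a+1\<^esub>\<close>. These hosts have about \<open>(b - 1) n\<close> and \<open>2 (a - 1) n\<close> edges, and one of
  \<open>b - 1\<close> and \<open>2 (a - 1)\<close> is at least \<open>2 (t - 2) / 3\<close>.

  Upper bound: take the spider with \<open>2 m\<close> legs, \<open>m\<close> of length two and \<open>m\<close> of length one, so
  \<open>t = 3 m + 1\<close>. A bipartite graph with more than \<open>2 m n\<close> edges on \<open>2 n\<close> vertices has a subgraph of
  minimum degree greater than \<open>m\<close> and average degree greater than \<open>2 m\<close>. A vertex of degree greater
  than \<open>2 m\<close> in it serves as the centre, and the long legs are extended greedily.
\<close>

section \<open>Walks, copies and extremal numbers\<close>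

text \<open>Equality propagates edge by edge along a walk. It is applied below to component labels
  and to the agreement of two colourings.\<close>

lemma connected_graph_constant:
  assumes "connected_graph G" and edge: "\<And>u v. {u, v} \<in> edges G \<Longrightarrow> \<phi> u = \<phi> v"
    and "u \<in> verts G" "v \<in> verts G"
  shows "\<phi> u = \<phi> v"
proof -
  have *: "\<phi> (hd p) = \<phi> (last p)"
    if "p \<noteq> []" "successively (\<lambda>u v. {u, v} \<in> edges G) p" for p
    using that
  proof (induction p rule: induct_list012)
    case (3 x y zs)
    then show ?case using edge[of x y] by auto
  qed auto
  obtain p where "is_walk G p" "hd p = u" "last p = v"
    using assms unfolding connected_graph_def by blast
  then show ?thesis using *[of p] by (auto simp: is_walk_def)
qed

lemma contains_copyI:
  assumes "simple_graph T" "inj_on f (verts T)" "f ` verts T \<subseteq> verts G"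
    and "\<And>e. e \<in> edges T \<Longrightarrow> f ` e \<in> edges G"
  shows "contains_copy G T"
proof -
  let ?S = "(f ` verts T, (\<lambda>e. f ` e) ` edges T)"
  have "card (f ` e) = 2 \<and> f ` e \<subseteq> f ` verts T" if "e \<in> edges T" for e
  proof -
    have "e \<subseteq> verts T" "card e = 2" using that assms(1) by (auto simp: simple_graph_def)
    then show ?thesis
      using card_image[OF inj_on_subset[OF assms(2)]] by (metis image_mono)
  qed
  then have "simple_graph ?S" using assms(1) by (auto simp: simple_graph_def)
  moreover have "is_subgraph ?S G" using assms by (auto simp: is_subgraph_def)
  moreover have "isomorphic_graphs T ?S"
    using assms(2) unfolding isomorphic_graphs_def by (auto simp: bij_betw_def)
  ultimately show ?thesis unfolding contains_copy_def by blast
qed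

lemma contains_copyE:
  assumes "contains_copy G T"
  obtains f where "inj_on f (verts T)" "f ` verts T \<subseteq> verts G"
    and "\<forall>u v. {u, v} \<in> edges T \<longrightarrow> {f u, f v} \<in> edges G"
proof -
  obtain S f where S: "is_subgraph S G" "bij_betw f (verts T) (verts S)"
    "edges S = (\<lambda>e. f ` e) ` edges T"
    using assms unfolding contains_copy_def isomorphic_graphs_def by blast
  have "{f u, f v} \<in> edges G" if "{u, v} \<in> edges T" for u v
  proof -
    have "f ` {u, v} \<in> edges S" using that S(3) by blast
    then show ?thesis using S(1) by (auto simp: is_subgraph_def)
  qed
  then show ?thesis using S that by (auto simp: bij_betw_def is_subgraph_def)
qed

text \<open>A crude bound that makes the set under \<open>Max\<close> in \<open>ex_b\<close>
  finite.\<close>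

lemma balanced_bipartite_card_edges:
  assumes "balanced_bipartite n G"
  shows "card (edges G) \<le> n * n"
proof -
  obtain A B where AB: "verts G = A \<union> B" "card A = n" "card B = n"
    "\<forall>e\<in>edges G. \<exists>a\<in>A. \<exists>b\<in>B. e = {a, b}" and fin: "finite (verts G)"
    using assms unfolding balanced_bipartite_def simple_graph_def by blast
  have "finite (A \<times> B)" using fin AB by auto
  moreover have "edges G \<subseteq> (\<lambda>(a, b). {a, b}) ` (A \<times> B)" using AB by fastforce
  ultimately have "card (edges G) \<le> card (A \<times> B)" by (rule surj_card_le)
  then show ?thesis using AB by (simp add: card_cartesian_product)
qed

lemma finite_ex_b_set:
  "finite {card (edges G) | G :: nat ugraph. balanced_bipartite n G \<and> \<not> contains_copy G T}"
  by (rule finite_subset[of _ "{..n * n}"]) (use balanced_bipartite_card_edges in blast, simp)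

lemma ex_b_ge:
  fixes G :: "nat ugraph"
  assumes "balanced_bipartite n G" "\<not> contains_copy G T"
  shows "card (edges G) \<le> ex_b n T"
  unfolding ex_b_def using assms by (intro Max_ge finite_ex_b_set) blast

text \<open>The graph \<open>G\<close> witnesses that the set under \<open>Max\<close> is nonempty;
  otherwise its maximum would be unspecified.\<close>

lemma ex_b_le:
  fixes G :: "nat ugraph"
  assumes "balanced_bipartite n G" "\<not> contains_copy G T"
    and "\<And>H :: nat ugraph. balanced_bipartite n H \<Longrightarrow> \<not> contains_copy H T \<Longrightarrow> card (edges H) \<le> k"
  shows "ex_b n T \<le> k"
  unfolding ex_b_def using assms by (intro Max.boundedI finite_ex_b_set) blast+

section \<open>Disjoint unions of complete bipartite graphs\<close>

text \<open>Even vertices \<open>2 * i\<close> form one side and odd vertices \<open>2 * j + 1\<close> the other; the labels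
  \<open>c i\<close> and \<open>d j\<close> name the component.\<close>

definition label_graph :: "nat \<Rightarrow> (nat \<Rightarrow> 'c) \<Rightarrow> (nat \<Rightarrow> 'c) \<Rightarrow> nat ugraph" where
  "label_graph n c d =
     ((\<lambda>i. 2 * i) ` {..<n} \<union> (\<lambda>j. 2 * j + 1) ` {..<n},
      (\<lambda>(i, j). {2 * i, 2 * j + 1}) ` {(i, j). i < n \<and> j < n \<and> c i = d j})"

lemma balanced_bipartite_label_graph: "balanced_bipartite n (label_graph n c d)"
proof -
  have 1: "simple_graph (label_graph n c d)"
    by (auto simp: simple_graph_def label_graph_def card_insert_if double_not_eq_Suc_double)
  let ?A = "(\<lambda>i::nat. 2 * i) ` {..<n}" and ?B = "(\<lambda>j::nat. 2 * j + 1) ` {..<n}"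
  have "card ?A = n" "card ?B = n" by (subst card_image; simp add: inj_on_def)+
  moreover have "?A \<inter> ?B = {}" by (auto simp: double_not_eq_Suc_double)
  moreover have "\<forall>e\<in>edges (label_graph n c d). \<exists>a\<in>?A. \<exists>b\<in>?B. e = {a, b}"
    by (auto simp: label_graph_def)
  moreover have "verts (label_graph n c d) = ?A \<union> ?B" by (simp add: label_graph_def)
  ultimately show ?thesis using 1 unfolding balanced_bipartite_def by blast
qed

lemma card_edges_label_graph:
  "card (edges (label_graph n c d)) = card {(i, j). i < n \<and> j < n \<and> c i = d j}"
proof -
  have "inj_on (\<lambda>(i, j). {2 * i, 2 * j + 1 :: nat}) X" for X
    by (auto simp: inj_on_def doubleton_eq_iff double_not_eq_Suc_double Suc_double_not_eq_double)
  then show ?thesis by (simp add: label_graph_def card_image)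
qed

section \<open>Two-colourings and connected copies inside label graphs\<close>

definition proper_colouring :: "'a ugraph \<Rightarrow> ('a \<Rightarrow> bool) \<Rightarrow> bool" where
  "proper_colouring G \<chi> \<longleftrightarrow> (\<forall>u v. {u, v} \<in> edges G \<longrightarrow> \<chi> u \<noteq> \<chi> v)"

text \<open>Both colours flip along every edge, so whether the two colourings agree is constant on a
  connected graph.\<close>

lemma proper_colouring_unique:
  assumes "connected_graph G" "proper_colouring G \<chi>" "proper_colouring G \<psi>"
  shows "(\<forall>v\<in>verts G. \<psi> v = \<chi> v) \<or> (\<forall>v\<in>verts G. \<psi> v = (\<not> \<chi> v))"
proof -
  have "(\<chi> u = \<psi> u) = (\<chi> v = \<psi> v)" if "{u, v} \<in> edges G" for u v
    using that assms(2,3) unfolding proper_colouring_def by metis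
  then have "(\<chi> u = \<psi> u) = (\<chi> v = \<psi> v)" if "u \<in> verts G" "v \<in> verts G" for u v
    using connected_graph_constant[OF assms(1) _ that, of "\<lambda>v. \<chi> v = \<psi> v"] by simp
  then show ?thesis by metis
qed

text \<open>A connected copy stays inside one component, whose label is \<open>q\<close>. The parity
  of the image vertex is a proper colouring, and halving maps each colour class injectively into one
  side of that component.\<close>

lemma label_graph_copyE:
  assumes "contains_copy (label_graph n c d) T" "connected_graph T"
  obtains \<chi> q where "proper_colouring T \<chi>"
    "card {v \<in> verts T. \<chi> v} \<le> card {i. i < n \<and> c i = q}"
    "card {v \<in> verts T. \<not> \<chi> v} \<le> card {j. j < n \<and> d j = q}"
proof -
  obtain f where f: "inj_on f (verts T)" "f ` verts T \<subseteq> verts (label_graph n c d)"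
    "\<forall>u v. {u, v} \<in> edges T \<longrightarrow> {f u, f v} \<in> edges (label_graph n c d)"
    using assms(1) by (rule contains_copyE)
  \<comment> \<open>The component label read off from a host vertex of either side.\<close>
  define lab where "lab x = (if even x then c (x div 2) else d (x div 2))" for x
  have edge: "even x \<noteq> even y \<and> lab x = lab y" if "{x, y} \<in> edges (label_graph n c d)" for x y
    using that by (auto simp: label_graph_def doubleton_eq_iff lab_def)
  obtain r where r: "r \<in> verts T" using assms(2) by (auto simp: connected_graph_def)
  define q where "q = lab (f r)"
  have lab: "lab (f v) = q" if "v \<in> verts T" for v
    unfolding q_def using connected_graph_constant[OF assms(2) _ that r, of "\<lambda>v. lab (f v)"] f(3) edge
    by blast
  have lt: "f v div 2 < n" if "v \<in> verts T" for v
    using f(2) that by (force simp: label_graph_def)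
  have inj: "inj_on (\<lambda>v. f v div 2) {v \<in> verts T. even (f v) = b}" for b
  proof (rule inj_onI)
    fix u v assume uv: "u \<in> {v \<in> verts T. even (f v) = b}" "v \<in> {v \<in> verts T. even (f v) = b}"
      "f u div 2 = f v div 2"
    then have "f u = f v"
      by (metis (mono_tags, lifting) div_mult_mod_eq mem_Collect_eq parity_cases)
    then show "u = v" using uv f(1) by (auto dest: inj_onD)
  qed
  show ?thesis
  proof (rule that[of "\<lambda>v. even (f v)" q])
    show "proper_colouring T (\<lambda>v. even (f v))"
      unfolding proper_colouring_def using f(3) edge by blast
    have "c (f v div 2) = q" if "v \<in> verts T" "even (f v)" for v
      using lab[OF that(1)] that(2) by (simp add: lab_def)
    then show "card {v \<in> verts T. even (f v)} \<le> card {i. i < n \<and> c i = q}"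
      using inj[of True] lt by (intro card_inj_on_le[of "\<lambda>v. f v div 2"]) auto
    have "d (f v div 2) = q" if "v \<in> verts T" "odd (f v)" for v
      using lab[OF that(1)] that(2) by (simp add: lab_def)
    then show "card {v \<in> verts T. odd (f v)} \<le> card {j. j < n \<and> d j = q}"
      using inj[of False] lt by (intro card_inj_on_le[of "\<lambda>v. f v div 2"]) auto
  qed
qed

text \<open>Bipartiteness is not assumed: without a proper colouring, any \<open>a\<close> and \<open>b\<close> will do.\<close>

lemma colour_class_sizes:
  assumes "simple_graph T" "connected_graph T"
  obtains a b where "a \<le> b" "a + b = card (verts T)"
    "\<And>\<chi>. proper_colouring T \<chi> \<Longrightarrow>
      min (card {v \<in> verts T. \<chi> v}) (card {v \<in> verts T. \<not> \<chi> v}) = a \<and>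
      max (card {v \<in> verts T. \<chi> v}) (card {v \<in> verts T. \<not> \<chi> v}) = b"
proof (cases "\<exists>\<chi>. proper_colouring T \<chi>")
  case True
  then obtain \<chi> where \<chi>: "proper_colouring T \<chi>" by blast
  let ?P = "{v \<in> verts T. \<chi> v}" and ?Q = "{v \<in> verts T. \<not> \<chi> v}"
  have "finite (verts T)" using assms by (auto simp: simple_graph_def)
  then have "card (?P \<union> ?Q) = card ?P + card ?Q" by (intro card_Un_disjoint) auto
  moreover have "?P \<union> ?Q = verts T" by auto
  ultimately have sum: "card ?P + card ?Q = card (verts T)" by simp
  show ?thesis
  proof (rule that[of "min (card ?P) (card ?Q)" "max (card ?P) (card ?Q)"])
    fix \<psi> assume "proper_colouring T \<psi>"
    then have "{v \<in> verts T. \<psi> v} = ?P \<and> {v \<in> verts T. \<not> \<psi> v} = ?Q \<or>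
        {v \<in> verts T. \<psi> v} = ?Q \<and> {v \<in> verts T. \<not> \<psi> v} = ?P"
      using proper_colouring_unique[OF assms(2) \<chi>] by blast
    then show "min (card {v \<in> verts T. \<psi> v}) (card {v \<in> verts T. \<not> \<psi> v}) = min (card ?P) (card ?Q) \<and>
        max (card {v \<in> verts T. \<psi> v}) (card {v \<in> verts T. \<not> \<psi> v}) = max (card ?P) (card ?Q)"
      by (auto simp: min.commute max.commute)
  qed (use sum in \<open>auto simp: min_def max_def\<close>)
next
  case False
  then show ?thesis using that[of 0 "card (verts T)"] by auto
qed

section \<open>The two constructions for the lower bound\<close>

text \<open>The host is \<open>k\<close> disjoint copies of \<open>K_{s,s}\<close>: the larger
  colour class fits into no side of a component. Orders that are multiples of \<open>s\<close> are
  enough for a limsup.\<close>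

lemma ex_b_ge_blocks:
  assumes "connected_graph T"
    and "\<And>\<chi>. proper_colouring T \<chi> \<Longrightarrow>
      s < max (card {v \<in> verts T. \<chi> v}) (card {v \<in> verts T. \<not> \<chi> v})"
    and "s > 0"
  shows "s * (s * k) \<le> ex_b (s * k) T"
proof -
  let ?G = "label_graph (s * k) (\<lambda>i. i div s) (\<lambda>j. j div s)"
  have block: "card {i. i < s * k \<and> i div s = q} \<le> s" for q
  proof -
    have "{i. i < s * k \<and> i div s = q} \<subseteq> {q * s..<q * s + s}"
      using \<open>s > 0\<close> by (auto simp: dividend_less_div_times intro: add.commute)
        (metis dividend_less_div_times add.commute)
    then have "card {i. i < s * k \<and> i div s = q} \<le> card {q * s..<q * s + s}"
      by (intro card_mono) auto
    then show ?thesis by simp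
  qed
  have "\<not> contains_copy ?G T"
  proof
    assume "contains_copy ?G T"
    then obtain \<chi> q where "proper_colouring T \<chi>"
      "card {v \<in> verts T. \<chi> v} \<le> card {i. i < s * k \<and> i div s = q}"
      "card {v \<in> verts T. \<not> \<chi> v} \<le> card {i. i < s * k \<and> i div s = q}"
      by (rule label_graph_copyE[OF _ assms(1)])
    then show False using assms(2)[of \<chi>] block[of q] by linarith
  qed
  then have "card (edges ?G) \<le> ex_b (s * k) T"
    by (intro ex_b_ge balanced_bipartite_label_graph)
  moreover have "s * (s * k) \<le> card (edges ?G)"
  proof -
    let ?X = "{..<k} \<times> {..<s} \<times> {..<s}"
    let ?Y = "{(i, j). i < s * k \<and> j < s * k \<and> i div s = j div s}"
    have lt: "s * p + i < s * k" if "p < k" "i < s" for p i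
    proof -
      have "s * p + i < s * Suc p" using that by simp
      also have "\<dots> \<le> s * k" using that by (intro mult_le_mono2) simp
      finally show ?thesis .
    qed
    have "card ?X \<le> card ?Y"
    \<comment> \<open>A triple \<open>(p, i, j)\<close> stands for the edge joining offset
      \<open>i\<close> to offset \<open>j\<close> in block \<open>p\<close>.\<close>
    proof (rule card_inj_on_le[of "\<lambda>(p, i, j). (s * p + i, s * p + j)"])
      show "inj_on (\<lambda>(p, i, j). (s * p + i, s * p + j)) ?X"
      proof (rule inj_onI, clarsimp)
        fix p i j p' i' j'
        assume h: "i < s" "i' < s" "s * p + i = s * p' + i'" "s * p + j = s * p' + j'"
        from h have "(s * p + i) div s = (s * p' + i') div s" by simp
        then have "p = p'" using h(1,2) \<open>s > 0\<close> by simp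
        then show "p = p' \<and> i = i' \<and> j = j'" using h by simp
      qed
      show "finite ?Y" by (rule finite_subset[of _ "{..<s * k} \<times> {..<s * k}"]) auto
    qed (use lt in auto)
    then show ?thesis by (simp add: card_edges_label_graph card_cartesian_product mult_ac)
  qed
  ultimately show ?thesis by linarith
qed

text \<open>The host consists of \<open>K_{r,n-r}\<close> and its mirror image. Each component has a
  side of only \<open>r\<close> vertices, too small even for the smaller colour class.\<close>

lemma ex_b_ge_split:
  assumes "connected_graph T"
    and "\<And>\<chi>. proper_colouring T \<chi> \<Longrightarrow>
      r < min (card {v \<in> verts T. \<chi> v}) (card {v \<in> verts T. \<not> \<chi> v})"
    and "r \<le> n"
  shows "2 * r * (n - r) \<le> ex_b n T"
proof -
  let ?G = "label_graph n (\<lambda>i. i < r) (\<lambda>j. \<not> j < r)"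
  have small: "card {i. i < n \<and> i < r} \<le> r"
    using card_mono[of "{..<r}" "{i. i < n \<and> i < r}"] by auto
  have "\<not> contains_copy ?G T"
  proof
    assume "contains_copy ?G T"
    then obtain \<chi> q where "proper_colouring T \<chi>"
      "card {v \<in> verts T. \<chi> v} \<le> card {i. i < n \<and> (i < r) = q}"
      "card {v \<in> verts T. \<not> \<chi> v} \<le> card {j. j < n \<and> (\<not> j < r) = q}"
      by (rule label_graph_copyE[OF _ assms(1)])
    \<comment> \<open>For \<open>q = True\<close> the small side is the even one, for
      \<open>q = False\<close> the odd one.\<close>
    then show False using assms(2)[of \<chi>] small by (cases q) auto
  qed
  then have "card (edges ?G) \<le> ex_b n T"
    by (intro ex_b_ge balanced_bipartite_label_graph)
  moreover have "card (edges ?G) = 2 * r * (n - r)"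
  proof -
    have "{(i, j). i < n \<and> j < n \<and> (i < r) = (\<not> j < r)} =
        {..<r} \<times> {r..<n} \<union> {r..<n} \<times> {..<r}"
      using assms(3) by auto
    moreover have "card ({..<r} \<times> {r..<n} \<union> {r..<n} \<times> {..<r}) =
        card ({..<r} \<times> {r..<n}) + card ({r..<n} \<times> {..<r})"
      by (intro card_Un_disjoint) auto
    ultimately show ?thesis by (simp add: card_edges_label_graph card_cartesian_product)
  qed
  ultimately show ?thesis by simp
qed

section \<open>The lower bound for connected graphs\<close>

text \<open>Since \<open>(a - 1) + (b - 1) = t - 2\<close>, either \<open>b - 1\<close> is at least
  two thirds of \<open>t - 2\<close>, and the blocks win, or \<open>a - 1\<close> exceeds one third
  of it, and the split host wins.\<close>

lemma gamma_b_tree_ge: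
  assumes "simple_graph T" "connected_graph T" "card (verts T) \<ge> 3"
  shows "ereal (2 / 3) \<le> gamma_b_tree T"
proof -
  define t where "t = card (verts T)"
  define X where "X n = ereal (real (ex_b n T) / ((real t - 2) * real n))" for n
  have gamma: "gamma_b_tree T = limsup X"
    unfolding gamma_b_tree_def X_def t_def ..
  obtain a b where ab: "a \<le> b" "a + b = t"
    and sizes: "\<And>\<chi>. proper_colouring T \<chi> \<Longrightarrow>
      min (card {v \<in> verts T. \<chi> v}) (card {v \<in> verts T. \<not> \<chi> v}) = a \<and>
      max (card {v \<in> verts T. \<chi> v}) (card {v \<in> verts T. \<not> \<chi> v}) = b"
    using colour_class_sizes[OF assms(1,2)] unfolding t_def by blast
  have t: "t \<ge> 3" using assms by (simp add: t_def)
  show ?thesis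
  proof (cases "2 * (t - 2) \<le> 3 * (b - 1)")
    case True
    define s where "s = b - 1"
    have s: "s > 0" "s < b" using ab t by (auto simp: s_def)
    \<comment> \<open>\<open>Suc\<close> avoids the order 0, where the quotient is 0 by the
      convention for division.\<close>
    have "ereal (2 / 3) \<le> X (s * Suc k)" for k
    proof -
      have "s * (s * Suc k) \<le> ex_b (s * Suc k) T"
        using s sizes by (intro ex_b_ge_blocks assms(2)) auto
      then have e: "real s * real (s * Suc k) \<le> real (ex_b (s * Suc k) T)"
        by (metis of_nat_le_iff of_nat_mult)
      have "2 * (real t - 2) \<le> 3 * real s" using True ab t by (simp add: s_def)
      then have "2 / 3 * (real t - 2) * real (s * Suc k) \<le> real s * real (s * Suc k)"
        by (intro mult_right_mono) auto
      with e have "2 / 3 * ((real t - 2) * real (s * Suc k)) \<le> real (ex_b (s * Suc k) T)"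
        by linarith
      moreover have "(real t - 2) * real (s * Suc k) > 0" using s t by (simp del: mult_Suc_right of_nat_Suc)
      ultimately show ?thesis by (simp only: X_def ereal_less_eq pos_le_divide_eq)
    qed
    then have "ereal (2 / 3) \<le> limsup (X \<circ> (\<lambda>k. s * Suc k))"
      by (intro le_Limsup) auto
    also have "\<dots> \<le> limsup X"
      using s by (intro limsup_subseq_mono) (auto simp: strict_mono_def)
    finally show ?thesis by (simp add: gamma)
  next
    case False
    define r where "r = a - 1"
    have r: "r < a" "t - 2 \<le> 3 * r" using False ab t by (auto simp: r_def)
    \<comment> \<open>The factor \<open>1 - r / n\<close> isolates the loss of the split host, which
      vanishes in the limit.\<close>
    have "ereal (2 * real r / (real t - 2) * (1 - real r / real n)) \<le> X n" if n: "n \<ge> max 1 r" for n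
    proof -
      have "2 * r * (n - r) \<le> ex_b n T"
        using r sizes n by (intro ex_b_ge_split assms(2)) auto
      then have "real (2 * r * (n - r)) \<le> real (ex_b n T)" by (rule of_nat_mono)
      then have e: "2 * real r * (real n - real r) \<le> real (ex_b n T)" using n by (simp add: of_nat_diff)
      have "2 * real r / (real t - 2) * (1 - real r / real n) =
          2 * real r * (real n - real r) / ((real t - 2) * real n)"
        using n t by (simp add: divide_simps)
      also have "\<dots> \<le> real (ex_b n T) / ((real t - 2) * real n)"
        using e t by (intro divide_right_mono) auto
      finally show ?thesis by (simp add: X_def)
    qed
    then have "limsup (\<lambda>n. ereal (2 * real r / (real t - 2) * (1 - real r / real n))) \<le> limsup X"
      by (intro Limsup_mono) (auto simp: eventually_at_top_linorder intro!: exI[of _ "max 1 r"])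
    moreover have "limsup (\<lambda>n. ereal (2 * real r / (real t - 2) * (1 - real r / real n))) =
        ereal (2 * real r / (real t - 2) * (1 - 0))"
      by (intro lim_imp_Limsup tendsto_intros lim_const_over_n) simp
    ultimately have "ereal (2 * real r / (real t - 2)) \<le> limsup X" by simp
    moreover have "2 / 3 \<le> 2 * real r / (real t - 2)"
      using r t by (simp add: field_simps)
    ultimately show ?thesis unfolding gamma by (meson ereal_less_eq(3) order_trans)
  qed
qed

section \<open>Trees given by a parent function\<close>

lemma is_walk_rev: "is_walk G (rev p) \<longleftrightarrow> is_walk G p"
  by (simp add: is_walk_def insert_commute)

text \<open>Walks to a common root suffice: one is followed by the reverse of another.\<close>

lemma connected_graphI:
  assumes "r \<in> verts G" and walk: "\<And>v. v \<in> verts G \<Longrightarrow> \<exists>p. is_walk G p \<and> hd p = v \<and> last p = r"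
  shows "connected_graph G"
  unfolding connected_graph_def
proof (intro conjI ballI)
  fix u v assume "u \<in> verts G" "v \<in> verts G"
  then obtain p q where p: "is_walk G p" "hd p = u" "last p = r"
    and q: "is_walk G q" "hd q = v" "last q = r"
    using walk by meson
  \<comment> \<open>The root is dropped from the second walk; repeating it at the join would require
    a loop.\<close>
  obtain q' where q': "rev q = r # q'"
    using q by (cases q rule: rev_cases) (auto simp: is_walk_def)
  have rq: "is_walk G (r # q')" using q(1) q' by (metis is_walk_rev)
  have lq: "last (r # q') = v" using q q' by (metis is_walk_def last_rev)
  have "is_walk G (p @ q')"
    using p rq unfolding is_walk_def
    by (cases q') (auto simp: successively_append_iff)
  moreover have "hd (p @ q') = u" "last (p @ q') = v"
    using p lq by (auto simp: is_walk_def last_append)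
  ultimately show "\<exists>p. is_walk G p \<and> hd p = u \<and> last p = v" by blast
qed (use assms in auto)

text \<open>The cyclic predecessor and successor of \<open>v\<close> differ because a cycle has at
  least three vertices.\<close>

lemma is_cycle_neighbours:
  assumes "is_cycle G c" "v \<in> set c"
  obtains u w where "u \<in> set c" "w \<in> set c" "u \<noteq> w" "{v, u} \<in> edges G" "{v, w} \<in> edges G"
proof -
  define l where "l = length c"
  have c: "distinct c" "l \<ge> 3" "{last c, hd c} \<in> edges G" "c \<noteq> []"
    using assms by (auto simp: is_cycle_def l_def)
  have step: "{c ! i, c ! Suc i} \<in> edges G" if "Suc i < l" for i
    using assms that by (auto simp: is_cycle_def is_walk_def successively_conv_nth l_def)
  have close: "{c ! (l - 1), c ! 0} \<in> edges G"
    using c by (simp add: last_conv_nth hd_conv_nth l_def)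
  obtain i where i: "i < l" "v = c ! i" using assms(2) by (auto simp: in_set_conv_nth l_def)
  have ex: "\<exists>j k. j < l \<and> k < l \<and> j \<noteq> k \<and> {v, c ! j} \<in> edges G \<and> {v, c ! k} \<in> edges G"
  proof -
    \<comment> \<open>At the two ends of the list one of the neighbours comes from the closing
      edge.\<close>
    consider "i = 0" | "i = l - 1" "i \<noteq> 0" | "0 < i" "Suc i < l" using i by linarith
    then show ?thesis
    proof cases
      case 1
      then show ?thesis using step[of 0] close c i
        by (intro exI[of _ 1] exI[of _ "l - 1"]) (auto simp: insert_commute)
    next
      case 2
      then have "Suc (i - 1) = i" "i - 1 \<noteq> 0" using c by auto
      then show ?thesis using 2 step[of "i - 1"] close i
        by (intro exI[of _ 0] exI[of _ "i - 1"]) (auto simp: insert_commute)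
    next
      case 3
      then show ?thesis using step[of "i - 1"] step[of i] c i
        by (intro exI[of _ "i - 1"] exI[of _ "Suc i"]) (auto simp: insert_commute)
    qed
  qed
  then obtain j k where "j < l" "k < l" "j \<noteq> k" "{v, c ! j} \<in> edges G" "{v, c ! k} \<in> edges G"
    by blast
  then show ?thesis
    using that[of "c ! j" "c ! k"] c(1) by (auto simp: l_def nth_eq_iff_index_eq)
qed

text \<open>Vertex 0 is the root. Numbering parents below their children lets the order on
  \<open>nat\<close> rule out cycles.\<close>

definition parent_graph :: "nat \<Rightarrow> (nat \<Rightarrow> nat) \<Rightarrow> nat ugraph" where
  "parent_graph n par = ({..<n}, (\<lambda>i. {i, par i}) ` {0<..<n})"

text \<open>Following parents strictly decreases the vertex and so ends at 0, which gives
  connectedness.\<close>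

lemma is_tree_parent_graph:
  assumes "n > 0" and par: "\<And>i. 0 < i \<Longrightarrow> i < n \<Longrightarrow> par i < i"
  shows "is_tree (parent_graph n par)"
  unfolding is_tree_def
proof (intro conjI)
  let ?G = "parent_graph n par"
  show "simple_graph ?G"
    unfolding simple_graph_def
  proof (intro conjI ballI)
    fix e assume "e \<in> edges ?G"
    then obtain i where i: "0 < i" "i < n" "e = {i, par i}" by (auto simp: parent_graph_def)
    with par[OF i(1,2)] show "e \<subseteq> verts ?G" "card e = 2" by (auto simp: parent_graph_def)
  qed (simp add: parent_graph_def)
  have "\<exists>p. is_walk ?G p \<and> hd p = v \<and> last p = 0" if "v < n" for v
    using that
  proof (induction v rule: less_induct)
    case (less v)
    show ?case
    proof (cases "v = 0")
      case True
      then show ?thesis using assms(1)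
        by (intro exI[of _ "[0]"]) (auto simp: is_walk_def parent_graph_def)
    next
      case False
      then obtain p where p: "is_walk ?G p" "hd p = par v" "last p = 0"
        using less par[of v] by force
      have "{v, par v} \<in> edges ?G" using False less by (auto simp: parent_graph_def)
      then show ?thesis using p less
        by (intro exI[of _ "v # p"]) (auto simp: is_walk_def successively_Cons parent_graph_def)
    qed
  qed
  then show "connected_graph ?G"
    using assms(1) by (intro connected_graphI[of 0]) (auto simp: parent_graph_def)
  \<comment> \<open>Both neighbours of the largest vertex of a cycle would have to be its parent.\<close>
  show "\<nexists>c. is_cycle ?G c"
  proof
    assume "\<exists>c. is_cycle ?G c"
    then obtain c where c: "is_cycle ?G c" by blast
    then have ne: "set c \<noteq> {}" by (auto simp: is_cycle_def)
    define v where "v = Max (set c)"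
    have "v \<in> set c" using ne by (simp add: v_def)
    then obtain u w where uw: "u \<in> set c" "w \<in> set c" "u \<noteq> w" "{v, u} \<in> edges ?G" "{v, w} \<in> edges ?G"
      using is_cycle_neighbours[OF c] by blast
    have "x = par v" if x: "x \<in> set c" "{v, x} \<in> edges ?G" for x
    proof -
      have "x \<le> v" using x by (simp add: v_def)
      obtain i where i: "0 < i" "i < n" "{v, x} = {i, par i}"
        using x by (auto simp: parent_graph_def)
      then show ?thesis using par[OF i(1,2)] \<open>x \<le> v\<close> by (auto simp: doubleton_eq_iff)
    qed
    then show False using uw by metis
  qed
qed

section \<open>The spider\<close>

text \<open>The centre is 0 and its neighbours are \<open>1\<close> to \<open>2 * m\<close>. For
  \<open>i\<close> from 1 to \<open>m\<close>, the leaf \<open>2 * m + i\<close> lengthens the leg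
  through \<open>i\<close>.\<close>

definition spider :: "nat \<Rightarrow> nat ugraph" where
  "spider m = parent_graph (3 * m + 1) (\<lambda>i. if i \<le> 2 * m then 0 else i - 2 * m)"

lemma is_tree_spider: "is_tree (spider m)"
  unfolding spider_def by (rule is_tree_parent_graph) auto

lemma card_verts_spider: "card (verts (spider m)) = 3 * m + 1"
  by (simp add: spider_def parent_graph_def)

section \<open>Finding a spider in a dense bipartite graph\<close>

text \<open>Take \<open>W\<close> with the fewest vertices among the sets spanning more than
  \<open>m * card W\<close> edges. Deleting a vertex of degree at most \<open>m\<close> would
  preserve this excess.\<close>

lemma min_degree_subgraph:
  fixes m :: nat
  assumes "finite V" "finite E" "m * card V < card {e \<in> E. e \<subseteq> V}"
  obtains W where "W \<subseteq> V" "m * card W < card {e \<in> E. e \<subseteq> W}"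
    "\<And>v. v \<in> W \<Longrightarrow> m < card {e \<in> E. e \<subseteq> W \<and> v \<in> e}"
proof -
  let ?P = "\<lambda>W. W \<subseteq> V \<and> m * card W < card {e \<in> E. e \<subseteq> W}"
  obtain W where W: "?P W" and least: "\<And>W'. ?P W' \<Longrightarrow> card W \<le> card W'"
    using ex_has_least_nat[of ?P V card] assms by blast
  show ?thesis
  proof (rule that)
    fix v assume v: "v \<in> W"
    have finW: "finite W" using W assms finite_subset by blast
    have split: "{e \<in> E. e \<subseteq> W} = {e \<in> E. e \<subseteq> W - {v}} \<union> {e \<in> E. e \<subseteq> W \<and> v \<in> e}" by auto
    have "card {e \<in> E. e \<subseteq> W} \<le> card {e \<in> E. e \<subseteq> W - {v}} + card {e \<in> E. e \<subseteq> W \<and> v \<in> e}"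
      unfolding split by (rule card_Un_le)
    moreover have card: "card W = Suc (card (W - {v}))" using v finW by (metis card.remove)
    moreover have "\<not> ?P (W - {v})" using least[of "W - {v}"] card by auto
    then have "card {e \<in> E. e \<subseteq> W - {v}} \<le> m * card (W - {v})" using W by auto
    ultimately show "m < card {e \<in> E. e \<subseteq> W \<and> v \<in> e}" using W by auto
  qed (use W in auto)
qed

text \<open>When a representative of \<open>S k\<close> is chosen, fewer than \<open>m\<close>
  elements are taken already.\<close>

lemma greedy_transversal:
  assumes "\<And>i. i < m \<Longrightarrow> finite (S i) \<and> m \<le> card (S i)"
  shows "\<exists>h. inj_on h {..<m} \<and> (\<forall>i<m. h i \<in> S i)"
proof -
  have "\<exists>h. inj_on h {..<k} \<and> (\<forall>i<k. h i \<in> S i)" if "k \<le> m" for k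
    using that
  proof (induction k)
    case (Suc k)
    then obtain h where h: "inj_on h {..<k}" "\<forall>i<k. h i \<in> S i" by auto
    have "card (h ` {..<k}) < card (S k)"
      using assms[of k] Suc.prems card_image_le[of "{..<k}" h] by simp
    then obtain x where x: "x \<in> S k" "x \<notin> h ` {..<k}"
      by (meson card_mono finite_imageI finite_lessThan leD subsetI)
    have "inj_on (h(k := x)) {..<Suc k}"
      using h x by (auto simp: inj_on_def less_Suc_eq)
    moreover have "\<forall>i<Suc k. (h(k := x)) i \<in> S i" using h x by (auto simp: less_Suc_eq)
    ultimately show ?case by blast
  qed auto
  then show ?thesis by auto
qed

text \<open>As \<open>G\<close> has \<open>2 * n\<close> vertices, the hypothesis is the density
  condition of \<open>min_degree_subgraph\<close>. The function \<open>g\<close> picks the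
  neighbours of the centre \<open>v\<close>, and \<open>h\<close> the ends of the long legs.\<close>

lemma contains_spider:
  assumes "balanced_bipartite n G" "2 * m * n < card (edges G)"
  shows "contains_copy G (spider m)"
proof -
  obtain A B where AB: "verts G = A \<union> B" "A \<inter> B = {}" "card A = n" "card B = n"
    "\<forall>e\<in>edges G. \<exists>a\<in>A. \<exists>b\<in>B. e = {a, b}"
    using assms(1) unfolding balanced_bipartite_def by blast
  have fin: "finite (verts G)" and E: "\<And>e. e \<in> edges G \<Longrightarrow> e \<subseteq> verts G \<and> card e = 2"
    using assms(1) by (auto simp: balanced_bipartite_def simple_graph_def)
  \<comment> \<open>An infinite set has cardinality 0, contrary to the strict bound.\<close>
  have finE: "finite (edges G)" using assms(2) card.infinite by fastforce
  have edge: "u \<in> verts G \<and> v \<in> verts G \<and> (u \<in> A \<longleftrightarrow> v \<notin> A)" if "{u, v} \<in> edges G" for u v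
    using AB(1,2) bspec[OF AB(5) that] by (auto simp: doubleton_eq_iff)
  have "card (verts G) = 2 * n" using AB fin by (simp add: card_Un_disjoint)
  moreover have "{e \<in> edges G. e \<subseteq> verts G} = edges G" using E by auto
  ultimately obtain W where W: "W \<subseteq> verts G" "m * card W < card {e \<in> edges G. e \<subseteq> W}"
    "\<And>v. v \<in> W \<Longrightarrow> m < card {e \<in> edges G. e \<subseteq> W \<and> v \<in> e}"
    using min_degree_subgraph[OF fin finE, of m] assms(2) by (auto simp: mult_ac)
  define N where "N v = {u \<in> W. {v, u} \<in> edges G}" for v
  have finW: "finite W" using W(1) fin finite_subset by blast
  then have finN: "finite (N v)" for v by (auto simp: N_def)
  have deg: "card {e \<in> edges G. e \<subseteq> W \<and> v \<in> e} = card (N v)" if "v \<in> W" for v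
  proof -
    have "e \<in> (\<lambda>u. {v, u}) ` N v" if e: "e \<in> edges G" "e \<subseteq> W" "v \<in> e" for e
    proof -
      obtain x y where "e = {x, y}" using E e(1) by (meson card_2_iff)
      then have "e = {v, x} \<or> e = {v, y}" using e(3) by auto
      then obtain u where "e = {v, u}" by blast
      then show ?thesis using e by (auto simp: N_def)
    qed
    then have "{e \<in> edges G. e \<subseteq> W \<and> v \<in> e} = (\<lambda>u. {v, u}) ` N v"
      using that by (auto simp: N_def)
    moreover have "inj_on (\<lambda>u. {v, u}) (N v)" by (auto simp: inj_on_def doubleton_eq_iff)
    ultimately show ?thesis by (simp add: card_image)
  qed
  \<comment> \<open>Degrees in \<open>W\<close> sum to twice the number of its edges, hence to more
    than \<open>2 * m * card W\<close>.\<close>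
  obtain v where v: "v \<in> W" "2 * m < card (N v)"
  proof (rule ccontr)
    assume "\<not> thesis"
    then have "\<forall>v\<in>W. card (N v) \<le> 2 * m" using that by force
    then have "(\<Sum>v\<in>W. card {e \<in> edges G. e \<subseteq> W \<and> v \<in> e}) \<le> (\<Sum>v\<in>W. 2 * m)"
      by (intro sum_mono) (auto simp: deg)
    moreover have "(\<Sum>v\<in>W. card {e \<in> {e \<in> edges G. e \<subseteq> W}. v \<in> e}) = 2 * card {e \<in> edges G. e \<subseteq> W}"
    proof (rule sum_multicount)
      show "\<forall>e\<in>{e \<in> edges G. e \<subseteq> W}. card {v \<in> W. v \<in> e} = 2"
        using E by (auto simp: Collect_conj_eq Int_absorb1)
    qed (use finW finE in auto)
    ultimately show False using W(2) by (simp add: conj_assoc mult_ac)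
  qed
  obtain g where g: "inj_on g {..<2 * m}" "g ` {..<2 * m} \<subseteq> N v"
    using card_le_inj[of "{..<2 * m}" "N v"] finN v by auto
  then have gN: "g i \<in> N v" if "i < 2 * m" for i using that by blast
  \<comment> \<open>Each \<open>g i\<close> has more than \<open>m\<close> neighbours in
    \<open>W\<close>, so at least \<open>m\<close> besides \<open>v\<close>. Only \<open>v\<close>
    is excluded here; the vertices \<open>g j\<close> are avoided by bipartiteness.\<close>
  have "\<exists>h. inj_on h {..<m} \<and> (\<forall>i<m. h i \<in> N (g i) - {v})"
  proof (rule greedy_transversal)
    fix i assume "i < m"
    then have "g i \<in> W" using gN[of i] by (simp add: N_def)
    then have "m < card (N (g i))" using W(3)[of "g i"] deg by simp
    then show "finite (N (g i) - {v}) \<and> m \<le> card (N (g i) - {v})"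
      using finN[of "g i"] card_Diff1_le[of "N (g i)" v] by (auto simp: card_Diff_singleton_if)
  qed
  then obtain h where h: "inj_on h {..<m}" "\<And>i. i < m \<Longrightarrow> h i \<in> N (g i) - {v}" by blast
  \<comment> \<open>\<open>f\<close> follows the numbering of the spider, shifted by one since
    \<open>g\<close> and \<open>h\<close> are indexed from 0.\<close>
  define f where "f x = (if x = 0 then v else if x \<le> 2 * m then g (x - 1) else h (x - (2 * m + 1)))" for x
  have gi: "{v, g i} \<in> edges G" if "i < 2 * m" for i using gN[OF that] by (simp add: N_def)
  have hi: "{g i, h i} \<in> edges G" "h i \<noteq> v" if "i < m" for i using h(2)[OF that] by (auto simp: N_def)
  have gA: "g i \<in> verts G \<and> (g i \<in> A \<longleftrightarrow> v \<notin> A)" if "i < 2 * m" for i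
    using edge[OF gi[OF that]] by blast
  \<comment> \<open>The leg ends lie on the side of \<open>v\<close> and the \<open>g i\<close> on
    the other, so the two kinds never collide.\<close>
  have hA: "h i \<in> verts G \<and> (h i \<in> A \<longleftrightarrow> v \<in> A)" if "i < m" for i
    using edge[OF hi(1)[OF that]] gA[of i] that by auto
  have f0: "f 0 = v" and fg: "\<And>i. i < 2 * m \<Longrightarrow> f (Suc i) = g i"
    and fh: "\<And>i. i < m \<Longrightarrow> f (Suc (2 * m + i)) = h i"
    by (auto simp: f_def)
  have cases: "x = 0 \<or> (\<exists>i<2 * m. x = Suc i) \<or> (\<exists>i<m. x = Suc (2 * m + i))" if "x < 3 * m + 1" for x
  proof -
    consider "x = 0" | "0 < x" "x \<le> 2 * m" | "2 * m < x" by linarith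
    then show ?thesis
    proof cases
      case 2
      then have "x - 1 < 2 * m" "x = Suc (x - 1)" by auto
      then show ?thesis by blast
    next
      case 3
      then have "x - (2 * m + 1) < m" "x = Suc (2 * m + (x - (2 * m + 1)))" using that by auto
      then show ?thesis by blast
    qed auto
  qed
  show ?thesis
  proof (rule contains_copyI[of _ f])
    show "simple_graph (spider m)" using is_tree_spider by (auto simp: is_tree_def)
    show "inj_on f (verts (spider m))"
    proof (rule inj_onI)
      fix x y assume xy: "x \<in> verts (spider m)" "y \<in> verts (spider m)" "f x = f y"
      have gv: "g i \<noteq> v" "v \<noteq> g i" if "i < 2 * m" for i using gA[OF that] by auto
      have gh: "g i \<noteq> h j" "h j \<noteq> g i" if "i < 2 * m" "j < m" for i j
        using gA[OF that(1)] hA[OF that(2)] by auto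
      have gg: "g i = g j \<longleftrightarrow> i = j" if "i < 2 * m" "j < 2 * m" for i j
        using inj_on_eq_iff[OF g(1)] that by simp
      have hh: "h i = h j \<longleftrightarrow> i = j" if "i < m" "j < m" for i j
        using inj_on_eq_iff[OF h(1)] that by simp
      have "x < 3 * m + 1" "y < 3 * m + 1" using xy by (auto simp: spider_def parent_graph_def)
      from cases[OF this(1)] cases[OF this(2)] show "x = y"
        using xy(3)
        by (elim disjE exE conjE) (simp_all add: f0 fg fh gv gh gg hh hi(2) hi(2)[symmetric])
    qed
    show "f ` verts (spider m) \<subseteq> verts G"
    proof (clarify)
      fix x assume "x \<in> verts (spider m)"
      then have "x < 3 * m + 1" by (simp add: spider_def parent_graph_def)
      from cases[OF this] show "f x \<in> verts G"
        using v(1) W(1) gA hA by (auto simp: f0 fg fh)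
    qed
    fix e assume "e \<in> edges (spider m)"
    then obtain x where x: "0 < x" "x < 3 * m + 1"
      "e = {x, if x \<le> 2 * m then 0 else x - 2 * m}"
      by (auto simp: spider_def parent_graph_def)
    from cases[OF x(2)] x(1)
    consider i where "i < 2 * m" "x = Suc i" | i where "i < m" "x = Suc (2 * m + i)" by blast
    then show "f ` e \<in> edges G"
    proof cases
      case 1
      then show ?thesis using x(3) gi[of i] by (simp add: f0 fg insert_commute)
    next
      case 2
      then have "e = {Suc (2 * m + i), Suc i}" using x(3) by auto
      then show ?thesis using 2 hi(1)[of i] by (simp add: fg fh insert_commute)
    qed
  qed
qed

section \<open>The upper bound for spiders\<close>

lemma ex_b_spider_le:
  assumes "m > 0"
  shows "ex_b n (spider m) \<le> 2 * m * n"
proof (rule ex_b_le)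
  \<comment> \<open>The labels never agree, so this is the edgeless graph, the spider-free witness
    for \<open>ex_b_le\<close>; the spider has an edge because \<open>m > 0\<close>.\<close>
  let ?G = "label_graph n (\<lambda>_. True) (\<lambda>_. False)"
  show "balanced_bipartite n ?G" by (rule balanced_bipartite_label_graph)
  show "\<not> contains_copy ?G (spider m)"
  proof
    assume "contains_copy ?G (spider m)"
    then obtain f where "inj_on f (verts (spider m))" "f ` verts (spider m) \<subseteq> verts ?G"
      "\<forall>u v. {u, v} \<in> edges (spider m) \<longrightarrow> {f u, f v} \<in> edges ?G"
      by (rule contains_copyE)
    moreover have "{1, 0} \<in> edges (spider m)"
      using assms by (auto simp: spider_def parent_graph_def intro!: image_eqI[of _ _ 1])
    ultimately have "edges ?G \<noteq> {}" by blast
    then show False by (auto simp: label_graph_def)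
  qed
  show "card (edges H) \<le> 2 * m * n"
    if "balanced_bipartite n H" "\<not> contains_copy H (spider m)" for H :: "nat ugraph"
    using contains_spider that by (meson not_le)
qed

lemma gamma_b_tree_spider_le:
  assumes "m > 0"
  shows "gamma_b_tree (spider m) \<le> ereal (2 * real m / (3 * real m - 1))"
  unfolding gamma_b_tree_def
proof (rule Limsup_bounded, rule eventually_mono[OF eventually_gt_at_top[of 0]])
  fix n :: nat assume n: "n > 0"
  have "real (ex_b n (spider m)) \<le> 2 * real m * real n"
    using ex_b_spider_le[OF assms, of n] by (metis of_nat_le_iff of_nat_mult of_nat_numeral)
  moreover have "real (card (verts (spider m))) - 2 = 3 * real m - 1"
    by (simp add: card_verts_spider)
  moreover have "3 * real m - 1 > 0" using assms by simp
  ultimately have "real (ex_b n (spider m)) / ((real (card (verts (spider m))) - 2) * real n)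
      \<le> 2 * real m * real n / ((3 * real m - 1) * real n)"
    by (simp only:, intro divide_right_mono) auto
  also have "\<dots> = 2 * real m / (3 * real m - 1)" using n by simp
  finally show "ereal (real (ex_b n (spider m)) / ((real (card (verts (spider m))) - 2) * real n))
      \<le> ereal (2 * real m / (3 * real m - 1))" by simp
qed

section \<open>The value of the limit\<close>

theorem theorem11:
  shows "((\<lambda>k. INF T\<in>trees_at_least k. gamma_b_tree T) \<longlonglongrightarrow> gamma_b) \<and> gamma_b = ereal (2 / 3)"
proof -
  \<comment> \<open>The sequence is constant from \<open>k = 3\<close> on, so its limit is
    immediate.\<close>
  have INF: "(INF T\<in>trees_at_least k. gamma_b_tree T) = ereal (2 / 3)" if "k \<ge> 3" for k
  proof (rule antisym)
    have "(\<lambda>m. 2 / (3 - 1 / real m)) \<longlonglongrightarrow> 2 / (3 - 0)"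
      by (intro tendsto_intros lim_const_over_n) auto
    then have "(\<lambda>m. ereal (2 / (3 - 1 / real m))) \<longlonglongrightarrow> ereal (2 / 3)" by simp
    \<comment> \<open>For fixed \<open>k\<close> every spider with \<open>m >= k\<close> competes in
      the infimum, which therefore lies below the limit of their bounds.\<close>
    moreover have "\<forall>m\<ge>k. (INF T\<in>trees_at_least k. gamma_b_tree T) \<le> ereal (2 / (3 - 1 / real m))"
    proof (intro allI impI)
      fix m assume m: "m \<ge> k"
      have "spider m \<in> trees_at_least k"
        using m by (simp add: trees_at_least_def is_tree_spider card_verts_spider)
      then have "(INF T\<in>trees_at_least k. gamma_b_tree T) \<le> gamma_b_tree (spider m)"
        by (rule INF_lower)
      also have "\<dots> \<le> ereal (2 * real m / (3 * real m - 1))"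
        using m that by (intro gamma_b_tree_spider_le) simp
      also have "2 * real m / (3 * real m - 1) = 2 / (3 - 1 / real m)"
        using m that by (simp add: field_simps)
      finally show "(INF T\<in>trees_at_least k. gamma_b_tree T) \<le> ereal (2 / (3 - 1 / real m))" .
    qed
    ultimately show "(INF T\<in>trees_at_least k. gamma_b_tree T) \<le> ereal (2 / 3)"
      by (intro LIMSEQ_le_const) blast+
    show "ereal (2 / 3) \<le> (INF T\<in>trees_at_least k. gamma_b_tree T)"
      using that by (intro INF_greatest gamma_b_tree_ge) (auto simp: trees_at_least_def is_tree_def)
  qed
  have lim: "(\<lambda>k. INF T\<in>trees_at_least k. gamma_b_tree T) \<longlonglongrightarrow> ereal (2 / 3)"
    by (rule tendsto_eventually) (auto simp: eventually_at_top_linorder intro!: exI[of _ 3] INF)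
  then have "gamma_b = ereal (2 / 3)" unfolding gamma_b_def by (rule limI)
  then show ?thesis using lim by simp
qed

end
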